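(* A space $X$ is $\mathbb R^{\omega_1}$-factorizable if and only if the product $X\times D(\omega_1)$ is $\mathbb R$-factorizable.
   Context: All topological spaces are assumed to be Tychonoff. $D(\omega_1)$ denotes the discrete space of cardinality $\omega_1$. A space $X$ is $\mathbb R^{\omega_1}$-factorizable if for every continuous function $f\colon X\to\mathbb R^{\omega_1}$ there exist a second-countable space $Y$ and continuous functions $h\colon X\to Y$ and $g\colon Y\to\mathbb R^{\omega_1}$ such that $f=g\circ h$. A product $X\times Y$ of spaces is $\mathbb R$-factorizable if for every continuous function $f\colon X\times Y\to\mathbb R$ there exist second-countable spaces $X'$ and $Y'$ and continuous functions $g\colon X\to X'$, $h\colon Y\to Y'$, and $\varphi\colon X'\times Y'\to\mathbb R$ such that $f=\varphi\circ(g\times h)$. *)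

theory Defs
  imports "HOL-Analysis.Analysis"
begin

definition tychonoff_space :: "'a topology \<Rightarrow> bool" where
  "tychonoff_space X \<longleftrightarrow> completely_regular_space X \<and> Hausdorff_space X"

(* cardSuc natLeq is a well-order of type omega_1 on its field, so the field is
   a set of cardinality aleph_1 (lemma card_of_omega1). *)
definition omega1 :: "nat set set" where
  "omega1 = Field (cardSuc natLeq)"

unbundle cardinal_syntax

lemma card_of_omega1: "|omega1| =o cardSuc natLeq"
  unfolding omega1_def
  by (rule card_of_Field_ordIso) (rule cardSuc_Card_order, rule natLeq_Card_order)

abbreviation D_omega1 :: "nat set topology" where
  "D_omega1 \<equiv> discrete_topology omega1"

(* Points are the real functions on omega1, extended by undefined outside omega1. *)
abbreviation R_pow_omega1 :: "(nat set \<Rightarrow> real) topology" where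
  "R_pow_omega1 \<equiv> product_topology (\<lambda>_. euclideanreal) omega1"

(* In the two definitions below, the second-countable Tychonoff spaces that are
   asserted to exist are topologies on arbitrary subsets of the type nat set.
   HOL cannot quantify over types inside a formula, but this loses nothing: by the
   following lemma every second-countable Tychonoff space is homeomorphic to such a
   space. *)
lemma second_countable_tychonoff_on_nat_set:
  fixes Y :: "'b topology"
  assumes "second_countable Y" "tychonoff_space Y"
  shows "\<exists>Z :: nat set topology. Y homeomorphic_space Z"
proof -
  obtain \<B> where \<B>: "countable \<B>" "\<And>V. V \<in> \<B> \<Longrightarrow> openin Y V"
      "\<And>U x. openin Y U \<Longrightarrow> x \<in> U \<Longrightarrow> \<exists>V\<in>\<B>. x \<in> V \<and> V \<subseteq> U"
    using assms(1) unfolding second_countable_def by meson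
  have t0: "t0_space Y"
    using assms(2) by (simp add: tychonoff_space_def Hausdorff_imp_t1_space t1_imp_t0_space)
  define e where "e x = to_nat_on \<B> ` {V \<in> \<B>. x \<in> V}" for x
  have inj: "inj_on e (topspace Y)"
  proof (rule inj_onI, rule ccontr)
    fix x y assume xy: "x \<in> topspace Y" "y \<in> topspace Y" "e x = e y" "x \<noteq> y"
    have "{V \<in> \<B>. x \<in> V} = {V \<in> \<B>. y \<in> V}"
      using xy(3) inj_on_image_eq_iff[OF inj_on_to_nat_on[OF \<B>(1)]] unfolding e_def by blast
    then have same: "x \<in> V \<longleftrightarrow> y \<in> V" if "V \<in> \<B>" for V
      using that by blast
    obtain U where "openin Y U" "x \<notin> U \<longleftrightarrow> y \<in> U"
      using t0 xy unfolding t0_space_def by blast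
    then show False
      using \<B>(3) same by (metis subsetD)
  qed
  define d where "d = inv_into (topspace Y) e"
  have de: "d (e x) = x" if "x \<in> topspace Y" for x
    using inj that unfolding d_def by simp
  define Z where "Z = pullback_topology (e ` topspace Y) d Y"
  have "continuous_map Z Y (id \<circ> d)"
    unfolding Z_def by (rule continuous_map_pullback) simp
  moreover have "continuous_map Y Z e"
    unfolding Z_def
  proof (rule continuous_map_pullback')
    show "continuous_map Y Y (d \<circ> e)"
      by (rule continuous_map_eq[OF continuous_map_id]) (simp add: de)
  qed auto
  moreover have "topspace Z = e ` topspace Y"
    unfolding Z_def topspace_pullback_topology using de by auto
  ultimately have "homeomorphic_maps Y Z e d"
    unfolding homeomorphic_maps_def using de by auto
  then show ?thesis
    unfolding homeomorphic_space_def by blast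
qed

definition R_omega1_factorizable :: "'a topology \<Rightarrow> bool" where
  "R_omega1_factorizable X \<longleftrightarrow>
    (\<forall>f. continuous_map X R_pow_omega1 f \<longrightarrow>
      (\<exists>(Y :: nat set topology) h g.
         tychonoff_space Y \<and> second_countable Y \<and>
         continuous_map X Y h \<and> continuous_map Y R_pow_omega1 g \<and>
         (\<forall>x \<in> topspace X. f x = (g \<circ> h) x)))"

definition R_factorizable_product :: "'a topology \<Rightarrow> 'b topology \<Rightarrow> bool" where
  "R_factorizable_product X Y \<longleftrightarrow>
    (\<forall>f. continuous_map (prod_topology X Y) euclideanreal f \<longrightarrow>
      (\<exists>(X' :: nat set topology) (Y' :: nat set topology) g h \<phi>.
         tychonoff_space X' \<and> second_countable X' \<and>
         tychonoff_space Y' \<and> second_countable Y' \<and>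
         continuous_map X X' g \<and> continuous_map Y Y' h \<and>
         continuous_map (prod_topology X' Y') euclideanreal \<phi> \<and>
         (\<forall>p \<in> topspace (prod_topology X Y). f p = (\<phi> \<circ> map_prod g h) p)))"

end

theory Submission
  imports Defs
begin

text \<open>
  Uncurrying turns a continuous \<open>f : X \<rightarrow> \<real>\<^sup>D\<close> into a continuous \<open>X \<times> D \<rightarrow> \<real>\<close>
  when \<open>D\<close> is discrete, and currying goes back.  A factorization of the uncurried map through
  \<open>X' \<times> Y'\<close> curries to a factorization of \<open>f\<close> through \<open>X'\<close>; this is one implication.

  For the other one, factoring the curried map through a second-countable \<open>Y\<close> leaves a family
  \<open>u \<alpha>\<close> of continuous real functions on \<open>Y\<close>, one for each point \<open>\<alpha>\<close> of \<open>D\<close>, and the index set has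
  to be mapped to a second-countable space in such a way that evaluation stays jointly continuous.
  Any map out of a discrete space is continuous, so only the target matters.  Fix a countable base
  of \<open>Y\<close> and send \<open>\<alpha>\<close> to its truth table: which base sets does \<open>u \<alpha>\<close> map into which
  rational intervals?  There are countably many such questions, so truth tables form a separable
  metrizable space, and a single positive answer controls the values of \<open>u \<alpha>\<close> on a whole base set for
  all \<open>\<alpha>\<close> sharing that answer.  Hence evaluation is well defined and jointly continuous on pairs
  of a point and a truth table (\<open>joint_factorization_of_family\<close>).
\<close>

lemma tychonoff_second_countable_subspace:
  fixes T :: "(nat \<Rightarrow> real) set"
  shows "tychonoff_space (top_of_set T)" "second_countable (top_of_set T)"
proof -
  have "metrizable_space (top_of_set T)"
    by (simp add: metrizable_space_euclidean metrizable_space_subtopology)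
  then show "tychonoff_space (top_of_set T)"
    by (simp add: tychonoff_space_def metrizable_imp_completely_regular_space
        metrizable_imp_Hausdorff_space)
  obtain \<B> :: "(nat \<Rightarrow> real) set set"
    where \<B>: "countable \<B>" "\<And>C. C \<in> \<B> \<Longrightarrow> open C"
      "\<And>S. open S \<Longrightarrow> \<exists>U. U \<subseteq> \<B> \<and> S = \<Union>U"
    using univ_second_countable by blast
  have "second_countable (euclidean :: (nat \<Rightarrow> real) topology)"
    unfolding second_countable_def
  proof (intro exI[of _ \<B>] conjI allI impI ballI)
    fix U and x :: "nat \<Rightarrow> real"
    assume "openin euclidean U \<and> x \<in> U"
    then show "\<exists>V\<in>\<B>. x \<in> V \<and> V \<subseteq> U"
      using \<B>(3)[of U] by auto
  qed (use \<B> in auto)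
  then show "second_countable (top_of_set T)"
    by (rule second_countable_subtopology)
qed

text \<open>
  Enumerating triples, instead of base sets and rational intervals separately, lets one sequence index
  run through all the questions of a truth table.  For empty \<open>Y\<close> the base may be empty, and then there is
  nothing to enumerate.
\<close>

lemma countable_base_sequence:
  assumes "second_countable (Y :: 'b topology)" "topspace Y \<noteq> {}"
  shows "\<exists>(V :: nat \<Rightarrow> 'b set) (p :: nat \<Rightarrow> rat) (q :: nat \<Rightarrow> rat).
    (\<forall>n. openin Y (V n)) \<and>
    (\<forall>U y a b. openin Y U \<longrightarrow> y \<in> U \<longrightarrow> (\<exists>n. y \<in> V n \<and> V n \<subseteq> U \<and> p n = a \<and> q n = b))"
proof -
  obtain \<B> where \<B>: "countable \<B>" "\<And>V. V \<in> \<B> \<Longrightarrow> openin Y V"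
      "\<And>U y. openin Y U \<Longrightarrow> y \<in> U \<Longrightarrow> \<exists>V\<in>\<B>. y \<in> V \<and> V \<subseteq> U"
    using assms(1) unfolding second_countable_def by meson
  define I where "I = \<B> \<times> (UNIV :: (rat \<times> rat) set)"
  define e where "e = from_nat_into I"
  have "\<B> \<noteq> {}"
    using \<B>(3)[OF openin_topspace] assms(2) by blast
  then have e: "range e = I"
    unfolding e_def I_def using \<B>(1) by (intro range_from_nat_into) auto
  show ?thesis
  proof (rule exI[of _ "fst \<circ> e"], rule exI[of _ "fst \<circ> snd \<circ> e"],
      rule exI[of _ "snd \<circ> snd \<circ> e"], intro conjI allI impI)
    fix n
    have "e n \<in> I" using e by blast
    then show "openin Y ((fst \<circ> e) n)"
      using \<B>(2) by (auto simp: I_def)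
  next
    fix U y a b
    assume "openin Y U" "y \<in> U"
    then obtain W where W: "W \<in> \<B>" "y \<in> W" "W \<subseteq> U"
      using \<B>(3) by blast
    then have "(W, a, b) \<in> range e"
      by (simp add: e I_def)
    then obtain n where "e n = (W, a, b)"
      by (metis rangeE)
    with W show "\<exists>n. y \<in> (fst \<circ> e) n \<and> (fst \<circ> e) n \<subseteq> U \<and> (fst \<circ> snd \<circ> e) n = a \<and> (snd \<circ> snd \<circ> e) n = b"
      by (intro exI[of _ n]) simp
  qed
qed

text \<open>
  The truth table \<open>h \<alpha>\<close> records, for each base set \<open>V n\<close> and rational interval, whether \<open>u \<alpha>\<close>
  maps the former into the latter.  By continuity every approximation to \<open>u \<alpha> y\<close> is witnessed
  by a positive entry, and that entry bounds all functions having it.  Letting the accuracy tend to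
  \<open>0\<close> shows that \<open>h \<alpha>\<close> determines \<open>u \<alpha>\<close>; at fixed accuracy it shows that
  evaluation is continuous, since having a given positive entry is an open condition.
\<close>

lemma joint_factorization_of_family:
  fixes Y :: "'b topology" and u :: "'c \<Rightarrow> 'b \<Rightarrow> real"
  assumes "second_countable Y"
    and cont: "\<And>\<alpha>. \<alpha> \<in> A \<Longrightarrow> continuous_map Y euclideanreal (u \<alpha>)"
  obtains h :: "'c \<Rightarrow> nat \<Rightarrow> real" and \<phi>
  where "continuous_map (prod_topology Y (top_of_set (h ` A))) euclideanreal \<phi>"
    and "\<And>y \<alpha>. y \<in> topspace Y \<Longrightarrow> \<alpha> \<in> A \<Longrightarrow> \<phi> (y, h \<alpha>) = u \<alpha> y"
proof (cases "topspace Y = {}")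
  case True
  have "continuous_map (prod_topology Y (top_of_set ((\<lambda>_ _. 0) ` A))) euclideanreal (\<lambda>_. 0)"
    by simp
  then show ?thesis
    using True that[of "\<lambda>_ _. 0" "\<lambda>_. 0"] by simp
next
  case False
  obtain V and p q :: "nat \<Rightarrow> rat" where V: "\<And>n. openin Y (V n)"
    and base: "\<And>U y a b. openin Y U \<Longrightarrow> y \<in> U \<Longrightarrow>
        \<exists>n::nat. y \<in> V n \<and> V n \<subseteq> U \<and> p n = a \<and> q n = b"
    using countable_base_sequence[OF assms(1) False] by blast
  define h :: "'c \<Rightarrow> nat \<Rightarrow> real" where
    "h \<alpha> n = of_bool (u \<alpha> ` V n \<subseteq> {of_rat (p n)<..<of_rat (q n)})" for \<alpha> n
  have witness: "\<exists>n. y \<in> V n \<and> h \<alpha> n = 1 \<and>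
      (\<forall>\<beta> z. h \<beta> n = 1 \<longrightarrow> z \<in> V n \<longrightarrow> \<bar>u \<beta> z - u \<alpha> y\<bar> < \<epsilon>)"
    if "\<alpha> \<in> A" and y: "y \<in> topspace Y" and "0 < \<epsilon>" for \<alpha> y and \<epsilon> :: real
  proof -
    obtain a where a: "u \<alpha> y - \<epsilon> < of_rat a" "of_rat a < u \<alpha> y"
      using of_rat_dense[of "u \<alpha> y - \<epsilon>" "u \<alpha> y"] \<open>0 < \<epsilon>\<close> by (metis diff_less_eq less_add_same_cancel1)
    obtain b where b: "u \<alpha> y < of_rat b" "of_rat b < u \<alpha> y + \<epsilon>"
      using of_rat_dense[of "u \<alpha> y" "u \<alpha> y + \<epsilon>"] \<open>0 < \<epsilon>\<close> by (metis less_add_same_cancel1)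
    have "openin Y {x \<in> topspace Y. u \<alpha> x \<in> {of_rat a<..<of_rat b}}"
      by (rule openin_continuous_map_preimage[OF cont[OF \<open>\<alpha> \<in> A\<close>]]) simp
    then obtain n where n: "y \<in> V n" "V n \<subseteq> {x \<in> topspace Y. u \<alpha> x \<in> {of_rat a<..<of_rat b}}"
        "p n = a" "q n = b"
      using base[of _ y a b] a b y by auto
    have "h \<alpha> n = 1"
      using n by (auto simp: h_def)
    moreover have "\<bar>u \<beta> z - u \<alpha> y\<bar> < \<epsilon>" if "h \<beta> n = 1" "z \<in> V n" for \<beta> z
    proof -
      have "u \<beta> z \<in> {of_rat a<..<of_rat b}"
        using that n(3,4) by (auto simp: h_def split: if_splits)
      then show ?thesis using a b by auto
    qed
    ultimately show ?thesis using n(1) by blast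
  qed
  have determined: "u \<alpha> y = u \<beta> y" if "\<alpha> \<in> A" "h \<alpha> = h \<beta>" "y \<in> topspace Y" for \<alpha> \<beta> y
  proof (rule ccontr)
    assume "u \<alpha> y \<noteq> u \<beta> y"
    then have "0 < \<bar>u \<beta> y - u \<alpha> y\<bar>" by simp
    from witness[OF that(1,3) this] show False
      using that(2) by (metis less_irrefl)
  qed
  define \<phi> where "\<phi> w = u (inv_into A h (snd w)) (fst w)" for w
  have \<phi>: "\<phi> (y, h \<alpha>) = u \<alpha> y" if "y \<in> topspace Y" "\<alpha> \<in> A" for y \<alpha>
    unfolding \<phi>_def fst_conv snd_conv
    by (rule determined) (use that in \<open>auto intro: inv_into_into simp: f_inv_into_f\<close>)
  let ?P = "prod_topology Y (top_of_set (h ` A))"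
  have "continuous_map ?P euclideanreal \<phi>"
    unfolding continuous_map_def
  proof (intro conjI allI impI)
    fix U :: "real set"
    assume "openin euclideanreal U"
    then have "open U" by simp
    show "openin ?P {w \<in> topspace ?P. \<phi> w \<in> U}"
    proof (subst openin_subopen, intro ballI)
      fix w assume w: "w \<in> {w \<in> topspace ?P. \<phi> w \<in> U}"
      then obtain y \<alpha> where y: "w = (y, h \<alpha>)" "y \<in> topspace Y" "\<alpha> \<in> A"
        by auto
      then have "u \<alpha> y \<in> U" using w \<phi> by auto
      then obtain \<epsilon> where \<epsilon>: "0 < \<epsilon>" "\<And>r. \<bar>r - u \<alpha> y\<bar> < \<epsilon> \<Longrightarrow> r \<in> U"
        using \<open>open U\<close> unfolding open_dist dist_real_def by metis
      obtain n where n: "y \<in> V n" "h \<alpha> n = 1"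
          "\<And>\<beta> z. h \<beta> n = 1 \<Longrightarrow> z \<in> V n \<Longrightarrow> \<bar>u \<beta> z - u \<alpha> y\<bar> < \<epsilon>"
        using witness[OF y(3,2) \<epsilon>(1)] by blast
      \<comment> \<open>Entries are \<open>0\<close> or \<open>1\<close>, so the open condition \<open>t n > 0\<close> says that entry \<open>n\<close> is positive.\<close>
      define W where "W = V n \<times> (h ` A \<inter> {t. 0 < t n})"
      have "open {t :: nat \<Rightarrow> real. 0 < t n}"
        by (intro open_Collect_less continuous_intros continuous_on_product_coordinates)
      then have "openin ?P W"
        unfolding W_def using V by (auto simp: openin_prod_Times_iff openin_open)
      moreover have "w \<in> W"
        using y n by (simp add: W_def)
      moreover have "W \<subseteq> {w \<in> topspace ?P. \<phi> w \<in> U}"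
      proof
        fix v assume "v \<in> W"
        then obtain z \<beta> where v: "v = (z, h \<beta>)" "z \<in> V n" "\<beta> \<in> A" "0 < h \<beta> n"
          by (auto simp: W_def)
        have "h \<beta> n = 1" using v(4) by (auto simp: h_def split: if_splits)
        moreover have "z \<in> topspace Y" using V v(2) openin_subset by blast
        ultimately show "v \<in> {w \<in> topspace ?P. \<phi> w \<in> U}"
          using v \<phi> n(3) \<epsilon>(2) by auto
      qed
      ultimately show "\<exists>T. openin ?P T \<and> w \<in> T \<and> T \<subseteq> {w \<in> topspace ?P. \<phi> w \<in> U}"
        by blast
    qed
  qed simp
  then show ?thesis using that \<phi> by blast
qed

lemma continuous_map_curry_discrete:
  "continuous_map (prod_topology X (discrete_topology A)) euclideanreal f \<longleftrightarrow>
    (\<forall>\<alpha>\<in>A. continuous_map X euclideanreal (\<lambda>x. f (x, \<alpha>)))"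
proof
  assume f: "continuous_map (prod_topology X (discrete_topology A)) euclideanreal f"
  show "\<forall>\<alpha>\<in>A. continuous_map X euclideanreal (\<lambda>x. f (x, \<alpha>))"
  proof
    fix \<alpha> assume "\<alpha> \<in> A"
    then have "continuous_map X (prod_topology X (discrete_topology A)) (\<lambda>x. (x, \<alpha>))"
      by (simp add: continuous_map_pairedI)
    from continuous_map_compose[OF this f]
    show "continuous_map X euclideanreal (\<lambda>x. f (x, \<alpha>))"
      by (simp add: o_def)
  qed
next
  assume f: "\<forall>\<alpha>\<in>A. continuous_map X euclideanreal (\<lambda>x. f (x, \<alpha>))"
  show "continuous_map (prod_topology X (discrete_topology A)) euclideanreal f"
    unfolding continuous_map_def
  proof (intro conjI allI impI)
    fix U :: "real set" assume U: "openin euclideanreal U"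
    \<comment> \<open>The preimage is the union of its horizontal slices, each of them open.\<close>
    have "{w \<in> topspace (prod_topology X (discrete_topology A)). f w \<in> U} =
        (\<Union>\<alpha>\<in>A. {x \<in> topspace X. f (x, \<alpha>) \<in> U} \<times> {\<alpha>})"
      by auto
    moreover have "openin (prod_topology X (discrete_topology A))
        ({x \<in> topspace X. f (x, \<alpha>) \<in> U} \<times> {\<alpha>})" if "\<alpha> \<in> A" for \<alpha>
      using openin_continuous_map_preimage[OF f[rule_format, OF that] U] that
      by (simp add: openin_prod_Times_iff)
    ultimately show "openin (prod_topology X (discrete_topology A))
        {w \<in> topspace (prod_topology X (discrete_topology A)). f w \<in> U}"
      by auto
  qed simp
qed

lemma R_factorizable_product_imp_R_omega1_factorizable:
  assumes "R_factorizable_product X D_omega1"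
  shows "R_omega1_factorizable X"
  unfolding R_omega1_factorizable_def
proof (intro allI impI)
  fix f assume f: "continuous_map X R_pow_omega1 f"
  have F: "continuous_map (prod_topology X D_omega1) euclideanreal (\<lambda>w. f (fst w) (snd w))"
    unfolding continuous_map_curry_discrete
    using f by (auto simp: continuous_map_componentwise)
  obtain X' :: "nat set topology" and Y' :: "nat set topology" and g h \<phi>
    where X': "tychonoff_space X'" "second_countable X'" "continuous_map X X' g"
      and h: "continuous_map D_omega1 Y' h"
      and \<phi>: "continuous_map (prod_topology X' Y') euclideanreal \<phi>"
      and eq: "\<forall>w \<in> topspace (prod_topology X D_omega1). f (fst w) (snd w) = (\<phi> \<circ> map_prod g h) w"
    using assms[unfolded R_factorizable_product_def, rule_format, OF F] by blast
  define G where "G x = (\<lambda>\<alpha>\<in>omega1. \<phi> (x, h \<alpha>))" for x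
  have "continuous_map X' euclideanreal (\<lambda>x. \<phi> (x, h \<alpha>))" if "\<alpha> \<in> omega1" for \<alpha>
  proof -
    have "h \<alpha> \<in> topspace Y'"
      using h that by auto
    then have "continuous_map X' (prod_topology X' Y') (\<lambda>x. (x, h \<alpha>))"
      by (simp add: continuous_map_pairedI)
    from continuous_map_compose[OF this \<phi>] show ?thesis
      by (simp add: o_def)
  qed
  then have "continuous_map X' R_pow_omega1 G"
    by (auto simp: continuous_map_componentwise G_def)
  moreover have "f x = (G \<circ> g) x" if "x \<in> topspace X" for x
  proof
    fix \<alpha>
    have "f x \<in> extensional omega1"
      using f that by (auto simp: continuous_map_componentwise)
    then show "f x \<alpha> = (G \<circ> g) x \<alpha>"
      using eq that by (auto simp: G_def extensional_def)
  qed
  ultimately show "\<exists>(Y :: nat set topology) h g. tychonoff_space Y \<and> second_countable Y \<and>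
      continuous_map X Y h \<and> continuous_map Y R_pow_omega1 g \<and> (\<forall>x\<in>topspace X. f x = (g \<circ> h) x)"
    using X' by blast
qed

lemma R_omega1_factorizable_imp_R_factorizable_product:
  assumes "R_omega1_factorizable X"
  shows "R_factorizable_product X D_omega1"
  unfolding R_factorizable_product_def
proof (intro allI impI)
  fix f assume f: "continuous_map (prod_topology X D_omega1) euclideanreal f"
  have F: "continuous_map X R_pow_omega1 (\<lambda>x. \<lambda>\<alpha>\<in>omega1. f (x, \<alpha>))"
    using f unfolding continuous_map_curry_discrete
    by (auto simp: continuous_map_componentwise)
  obtain Y :: "nat set topology" and g u
    where Y: "tychonoff_space Y" "second_countable Y" "continuous_map X Y g"
      and u: "continuous_map Y R_pow_omega1 u"
      and eq: "\<forall>x \<in> topspace X. (\<lambda>\<alpha>\<in>omega1. f (x, \<alpha>)) = (u \<circ> g) x"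
    using assms[unfolded R_omega1_factorizable_def, rule_format, OF F] by blast
  have "continuous_map Y euclideanreal (\<lambda>y. u y \<alpha>)" if "\<alpha> \<in> omega1" for \<alpha>
    using u that by (auto simp: continuous_map_componentwise)
  then obtain h :: "nat set \<Rightarrow> nat \<Rightarrow> real" and \<phi>
    where \<phi>: "continuous_map (prod_topology Y (top_of_set (h ` omega1))) euclideanreal \<phi>"
      and \<phi>_eq: "\<And>y \<alpha>. y \<in> topspace Y \<Longrightarrow> \<alpha> \<in> omega1 \<Longrightarrow> \<phi> (y, h \<alpha>) = u y \<alpha>"
    using joint_factorization_of_family[OF Y(2), of omega1 "\<lambda>\<alpha> y. u y \<alpha>"] by metis
  let ?T = "top_of_set (h ` omega1)"
  \<comment> \<open>The second factor has to consist of sets of naturals, so the truth tables are moved there.\<close>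
  obtain Z :: "nat set topology" where Z: "?T homeomorphic_space Z"
    using second_countable_tychonoff_on_nat_set tychonoff_second_countable_subspace by blast
  then obtain k k' where k: "homeomorphic_maps ?T Z k k'"
    unfolding homeomorphic_space_def by blast
  have Z': "tychonoff_space Z" "second_countable Z"
    using Z tychonoff_second_countable_subspace[of "h ` omega1"]
      homeomorphic_completely_regular_space homeomorphic_Hausdorff_space
      homeomorphic_space_second_countability
    unfolding tychonoff_space_def by blast+
  have kcont: "continuous_map ?T Z k" "continuous_map Z ?T k'"
    and k'k: "\<And>t. t \<in> h ` omega1 \<Longrightarrow> k' (k t) = t"
    using k by (auto simp: homeomorphic_maps_def)
  have "continuous_map D_omega1 Z (k \<circ> h)"
    using kcont(1) by (auto simp: continuous_map_def)
  moreover have "continuous_map (prod_topology Y Z) euclideanreal (\<phi> \<circ> map_prod id k')"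
  proof (rule continuous_map_compose[OF _ \<phi>])
    show "continuous_map (prod_topology Y Z) (prod_topology Y ?T) (map_prod id k')"
      using kcont(2) by (simp add: map_prod_def continuous_map_prod_top)
  qed
  moreover have "f w = (\<phi> \<circ> map_prod id k' \<circ> map_prod g (k \<circ> h)) w"
    if w_in: "w \<in> topspace (prod_topology X D_omega1)" for w
  proof -
    obtain x \<alpha> where w: "w = (x, \<alpha>)" "x \<in> topspace X" "\<alpha> \<in> omega1"
      using w_in by auto
    have "g x \<in> topspace Y"
      using Y(3) w(2) by (auto simp: continuous_map_def)
    then have "\<phi> (g x, h \<alpha>) = u (g x) \<alpha>"
      using \<phi>_eq w(3) by blast
    also have "\<dots> = f w"
      using eq w by (metis comp_apply restrict_apply')
    finally show ?thesis
      using w k'k by simp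
  qed
  ultimately show "\<exists>(X' :: nat set topology) (Y' :: nat set topology) g h \<phi>.
      tychonoff_space X' \<and> second_countable X' \<and> tychonoff_space Y' \<and> second_countable Y' \<and>
      continuous_map X X' g \<and> continuous_map D_omega1 Y' h \<and>
      continuous_map (prod_topology X' Y') euclideanreal \<phi> \<and>
      (\<forall>w \<in> topspace (prod_topology X D_omega1). f w = (\<phi> \<circ> map_prod g h) w)"
    using Y Z' by blast
qed

theorem proposition3p1:
  fixes X :: "'a topology"
  assumes "tychonoff_space X"
  shows "R_omega1_factorizable X \<longleftrightarrow> R_factorizable_product X D_omega1"
  using R_factorizable_product_imp_R_omega1_factorizable
    R_omega1_factorizable_imp_R_factorizable_product by blast

end
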